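(* Let $G$ be a finite group. Then $\mathscr{I}_c(G)$ is a star if and only if $G\cong \mathbb{Z}_{p^3}$ for some prime $p$.
   Context: For a group $G$, the intersection graph of cyclic subgroups of $G$, denoted $\mathscr{I}_c(G)$, is the simple graph whose vertices are all the proper cyclic subgroups of $G$ (cyclic subgroups different from $G$ and from the trivial subgroup), two distinct vertices being adjacent if and only if their intersection is a non-trivial subgroup. A star is a graph isomorphic to the complete bipartite graph $K_{1,n}$ for some $n\geq 1$. $\mathbb{Z}_m$ is the cyclic group of order $m$. *)

theory Defs
  imports
    "HOL-Algebra.Elementary_Groups"
    "HOL-Computational_Algebra.Primes"
    "Graph_Theory.Graph_Theory"
begin

definition proper_cyclic_subgroups :: "('a, 'b) monoid_scheme \<Rightarrow> 'a set set" where
  "proper_cyclic_subgroups G =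
    {H. subgroup H G \<and> cyclic_group (G\<lparr>carrier := H\<rparr>) \<and> H \<noteq> carrier G \<and> H \<noteq> {\<one>\<^bsub>G\<^esub>}}"

text \<open>As usual in the graph library, a simple graph is a symmetric loop-free digraph: an
  undirected edge between \<open>H\<close> and \<open>K\<close> is the pair of arcs \<open>(H, K)\<close> and \<open>(K, H)\<close>.\<close>

definition cyclic_intersection_graph :: "('a, 'b) monoid_scheme \<Rightarrow> 'a set pair_pre_digraph" where
  "cyclic_intersection_graph G =
    \<lparr> pverts = proper_cyclic_subgroups G,
      parcs = {(H, K). H \<in> proper_cyclic_subgroups G \<and> K \<in> proper_cyclic_subgroups G \<and>
                       H \<noteq> K \<and> H \<inter> K \<noteq> {\<one>\<^bsub>G\<^esub>}} \<rparr>"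

lemma pair_graph_cyclic_intersection_graph:
  assumes "finite (carrier G)"
  shows "pair_graph (cyclic_intersection_graph G)"
proof -
  have "proper_cyclic_subgroups G \<subseteq> Pow (carrier G)"
    by (auto simp: proper_cyclic_subgroups_def dest: subgroup.subset)
  then have fin: "finite (proper_cyclic_subgroups G)"
    using assms finite_subset by blast
  have "parcs (cyclic_intersection_graph G) \<subseteq> proper_cyclic_subgroups G \<times> proper_cyclic_subgroups G"
    by (auto simp: cyclic_intersection_graph_def)
  then have "finite (parcs (cyclic_intersection_graph G))"
    using fin finite_subset by blast
  then show ?thesis
    using fin
    by unfold_locales
      (auto simp: cyclic_intersection_graph_def symmetric_def arcs_ends_def arc_to_ends_def
        with_proj_def Int_commute intro!: symI)
qed

text \<open>The predicate \<open>complete_bipartite_digraph m n\<close>, written \<open>K\<^bsub>m,n\<^esub>\<close>, holds of exactly the graphs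
  isomorphic to the complete bipartite graph with parts of sizes \<open>m\<close> and \<open>n\<close>.\<close>

definition star_graph :: "('a, 'b) pre_digraph \<Rightarrow> bool" where
  "star_graph X \<longleftrightarrow> (\<exists>n\<ge>1. complete_bipartite_digraph 1 n X)"

end

theory Submission
  imports Defs "HOL-Algebra.Multiplicative_Group"
begin

text \<open>
  The vertices of the graph are the proper subgroups \<open>\<langle>x\<rangle>\<close> with \<open>x \<noteq> \<one>\<close>. In a star with centre \<open>C\<close> no
  vertex can lie strictly below both \<open>C\<close> and a leaf \<open>L\<close>, since it would form a triangle with them;
  as \<open>C\<close> and \<open>L\<close> meet non-trivially, one of them contains the other. If \<open>C \<subseteq> L\<close> for some leaf \<open>L\<close>,
  then any other leaf would meet \<open>L\<close> non-trivially, so \<open>L\<close> is the only leaf and contains every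
  vertex; otherwise \<open>C\<close> contains every vertex. Either way a single proper subgroup \<open>M\<close> contains
  all vertices, so each element outside \<open>M\<close> generates \<open>G\<close>. Hence \<open>G\<close> is cyclic, and its order is
  a prime power: if distinct primes \<open>q\<close> and \<open>r\<close> divided it, then \<open>g^q\<close> and \<open>g^r\<close> would lie in \<open>M\<close>
  for a generator \<open>g \<notin> M\<close>, and with them \<open>g\<close> (\<open>cyclic_prime_power_if_star\<close>).

  It remains to decide which cyclic groups of order \<open>p^k\<close> have a star as their graph. There the
  vertices are the \<open>k - 1\<close> intermediate members of the chain \<open>\<langle>g\<rangle> \<supset> \<langle>g^p\<rangle> \<supset> \<langle>g^(p^2)\<rangle> \<supset> \<dots>\<close>, so the
  graph is complete (\<open>proper_cyclic_subgroups_cyclic_prime_power\<close>). A complete graph is a star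
  exactly when it has two vertices, that is, when \<open>k = 3\<close>. Together with the previous paragraph
  this gives both directions of the equivalence.
\<close>

section \<open>Stars\<close>

lemma star_graph_with_proj_iff:
  "star_graph (with_proj X) \<longleftrightarrow>
     (\<exists>c V. finite V \<and> V \<noteq> {} \<and> c \<notin> V \<and> pverts X = insert c V \<and> parcs X = {c} \<times> V \<union> V \<times> {c})"
  (is "?L \<longleftrightarrow> ?R")
proof
  assume ?L
  then obtain U V where UV: "pverts X = U \<union> V" "U \<inter> V = {}" "card U = 1" "card V \<ge> 1"
      "parcs X = U \<times> V \<union> V \<times> U"
    unfolding star_graph_def complete_bipartite_digraph_pair_def by blast
  from \<open>card U = 1\<close> obtain c where "U = {c}" by (rule card_1_singletonE)
  moreover have "finite V" "V \<noteq> {}"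
    using \<open>card V \<ge> 1\<close> by (auto intro: card_ge_0_finite)
  ultimately show ?R using UV by auto
next
  assume ?R
  then obtain c V where V: "finite V" "V \<noteq> {}" "c \<notin> V" "pverts X = insert c V"
    "parcs X = {c} \<times> V \<union> V \<times> {c}" by blast
  have "card V \<ge> 1" using V(1,2) by (simp add: Suc_le_eq card_gt_0_iff)
  moreover have "finite (pverts X)" "pverts X = {c} \<union> V" "{c} \<inter> V = {}" "card {c} = 1"
    using V(1,3,4) by auto
  then have "complete_bipartite_digraph 1 (card V) (with_proj X)"
    unfolding complete_bipartite_digraph_pair_def using V(5) by blast
  ultimately show ?L unfolding star_graph_def by blast
qed

text \<open>Two distinct leaves of a star are not adjacent, so a complete star has a single leaf.\<close>

lemma star_graph_with_proj_complete_iff: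
  assumes "parcs X = {(u, v). u \<in> pverts X \<and> v \<in> pverts X \<and> u \<noteq> v}"
  shows "star_graph (with_proj X) \<longleftrightarrow> card (pverts X) = 2"
proof
  assume "star_graph (with_proj X)"
  then obtain c V where V: "V \<noteq> {}" "c \<notin> V" "pverts X = insert c V"
      "parcs X = {c} \<times> V \<union> V \<times> {c}"
    unfolding star_graph_with_proj_iff by blast
  from V(1) obtain v where "v \<in> V" by blast
  have "w = v" if "w \<in> V" for w
  proof (rule ccontr)
    assume "w \<noteq> v"
    then have "(w, v) \<in> parcs X" using assms V(3) \<open>v \<in> V\<close> that by blast
    then show False using V(2) \<open>v \<in> V\<close> that unfolding V(4) by blast
  qed
  then have "pverts X = {c, v}" using V(3) \<open>v \<in> V\<close> by blast
  moreover have "c \<noteq> v" using V(2) \<open>v \<in> V\<close> by blast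
  ultimately show "card (pverts X) = 2" by simp
next
  assume "card (pverts X) = 2"
  then obtain c v where cv: "pverts X = {c, v}" "c \<noteq> v" by (auto simp: card_2_iff)
  then have "parcs X = {c} \<times> {v} \<union> {v} \<times> {c}" unfolding assms by auto
  moreover have "finite {v}" "{v} \<noteq> {}" "c \<notin> {v}" using cv(2) by auto
  ultimately show "star_graph (with_proj X)"
    unfolding star_graph_with_proj_iff using cv(1) by blast
qed

section \<open>Cyclic subgroups and their generators\<close>

context group
begin

lemma cyclic_subgroup_iff_generate:
  assumes "subgroup H G"
  shows "cyclic_group (G\<lparr>carrier := H\<rparr>) \<longleftrightarrow> (\<exists>x\<in>H. generate G {x} = H)"
proof -
  have "subgroup_generated (G\<lparr>carrier := H\<rparr>) {x} = G\<lparr>carrier := H\<rparr> \<longleftrightarrow> generate G {x} = H"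
    if "x \<in> H" for x
  proof -
    have "generate (G\<lparr>carrier := H\<rparr>) {x} = generate G {x}"
      using generate_consistent[of "{x}" H] assms that by simp
    moreover have "G\<lparr>carrier := A\<rparr> = G\<lparr>carrier := B\<rparr> \<longleftrightarrow> A = B" for A B
      by (metis partial_object.select_convs(1) partial_object.surjective partial_object.update_convs(1))
    ultimately show ?thesis
      using that by (simp add: subgroup_generated_def)
  qed
  then show ?thesis unfolding cyclic_group_def by auto
qed

lemma generate_singleton_eq_one_iff:
  assumes "x \<in> carrier G"
  shows "generate G {x} = {\<one>} \<longleftrightarrow> x = \<one>"
  using generate.incl[of x "{x}" G] by (auto simp: generate_one)

text \<open>The generator, rather than the subgroup with its own group structure, is what all later
  arguments work with.\<close>

lemma mem_proper_cyclic_subgroups_iff: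
  "H \<in> proper_cyclic_subgroups G \<longleftrightarrow>
     (\<exists>x\<in>carrier G. x \<noteq> \<one> \<and> H = generate G {x}) \<and> H \<noteq> carrier G"
proof -
  have *: "subgroup H G \<and> (\<exists>x\<in>H. generate G {x} = H) \<longleftrightarrow> (\<exists>x\<in>carrier G. H = generate G {x})"
    by (metis empty_subsetI generate.incl generate_is_subgroup insert_subset singletonI
        subgroup.mem_carrier)
  have "H \<in> proper_cyclic_subgroups G \<longleftrightarrow>
      (subgroup H G \<and> (\<exists>x\<in>H. generate G {x} = H)) \<and> H \<noteq> carrier G \<and> H \<noteq> {\<one>}"
    unfolding proper_cyclic_subgroups_def using cyclic_subgroup_iff_generate by blast
  also have "\<dots> \<longleftrightarrow> (\<exists>x\<in>carrier G. x \<noteq> \<one> \<and> H = generate G {x}) \<and> H \<noteq> carrier G"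
    unfolding * using generate_singleton_eq_one_iff by blast
  finally show ?thesis .
qed

lemma cyclic_group_iff_generate:
  "cyclic_group G \<longleftrightarrow> (\<exists>g\<in>carrier G. generate G {g} = carrier G)"
  using cyclic_subgroup_iff_generate[OF subgroup_self] by simp

lemma generate_singleton_mono:
  assumes "y \<in> carrier G" "x \<in> generate G {y}"
  shows "generate G {x} \<subseteq> generate G {y}"
  using assms generate_is_subgroup by (intro generate_subgroup_incl) auto

lemma nat_pow_mem_generate:
  fixes k :: nat
  assumes "x \<in> carrier G"
  shows "x [^] k \<in> generate G {x}"
  unfolding generate_pow[OF assms] by (intro CollectI exI[of _ "int k"]) (simp add: int_pow_int)

text \<open>A non-trivial element of \<open>H \<inter> K\<close> generates a vertex inside \<open>H \<inter> K\<close>. In the graph of \<open>G\<close> such a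
  vertex is adjacent to each of \<open>H\<close> and \<open>K\<close> that it differs from, so the last assumption holds
  whenever the edge between \<open>H\<close> and \<open>K\<close> belongs to no triangle.\<close>

lemma proper_cyclic_subgroups_comparable_if:
  assumes H: "H \<in> proper_cyclic_subgroups G" and K: "K \<in> proper_cyclic_subgroups G"
    and int: "H \<inter> K \<noteq> {\<one>}"
    and no_third: "\<And>J. J \<in> proper_cyclic_subgroups G \<Longrightarrow> J \<subseteq> H \<inter> K \<Longrightarrow> J = H \<or> J = K"
  shows "H \<subseteq> K \<or> K \<subseteq> H"
proof -
  have sub: "subgroup H G" "subgroup K G" "H \<noteq> carrier G"
    using H K by (auto simp: proper_cyclic_subgroups_def)
  obtain x where x: "x \<in> H" "x \<in> K" "x \<noteq> \<one>"
    using int subgroup.one_closed[OF sub(1)] subgroup.one_closed[OF sub(2)] by blast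
  have xG: "x \<in> carrier G" using sub(1) x(1) by (rule subgroup.mem_carrier)
  have le: "generate G {x} \<subseteq> H" "generate G {x} \<subseteq> K"
    using x sub by (simp_all add: generate_subgroup_incl)
  then have "generate G {x} \<noteq> carrier G"
    using sub(3) subgroup.subset[OF sub(1)] by blast
  then have "generate G {x} \<in> proper_cyclic_subgroups G"
    using xG x(3) by (auto simp: mem_proper_cyclic_subgroups_iff)
  then show ?thesis using no_third[of "generate G {x}"] le by blast
qed

section \<open>Finite cyclic groups\<close>

text \<open>Bezout: \<open>u a + v b = 1\<close> writes \<open>g\<close> as a product of powers of \<open>g^a\<close> and \<open>g^b\<close>.\<close>

lemma mem_subgroup_if_coprime_powers:
  fixes a b :: nat
  assumes "subgroup M G" "g \<in> carrier G" "coprime a b" "g [^] a \<in> M" "g [^] b \<in> M"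
  shows "g \<in> M"
proof -
  obtain u v :: int where uv: "u * int a + v * int b = 1"
    using bezout_int[of "int a" "int b"] assms(3) by auto
  have "(g [^] a) [^] u \<otimes> (g [^] b) [^] v \<in> M"
    using assms by (intro subgroup.m_closed subgroup_int_pow_closed)
  also have "(g [^] a) [^] u \<otimes> (g [^] b) [^] v = g [^] (u * int a + v * int b)"
    using assms(2) by (simp add: int_pow_pow int_pow_mult mult.commute flip: int_pow_int)
  finally show ?thesis using uv assms(2) by simp
qed

text \<open>Some \<open>g\<close> lies outside \<open>M\<close> and therefore generates \<open>G\<close>. For a prime \<open>q\<close> dividing the order of
  \<open>G\<close> the power \<open>g^q\<close> has smaller order, hence lies in \<open>M\<close>; two different primes \<open>q\<close> would therefore
  put \<open>g\<close> itself into \<open>M\<close>.\<close>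

lemma cyclic_prime_power_if_nongenerators_subset:
  assumes fin: "finite (carrier G)" and M: "subgroup M G" "M \<noteq> carrier G"
    and nongen: "\<And>x. x \<in> carrier G \<Longrightarrow> generate G {x} \<noteq> carrier G \<Longrightarrow> x \<in> M"
  shows "cyclic_group G \<and> (\<exists>p k. prime p \<and> order G = p ^ k)"
proof -
  obtain g where g: "g \<in> carrier G" "g \<notin> M"
    using M subgroup.subset by blast
  then have gen: "generate G {g} = carrier G" using nongen by blast
  have ordg: "ord g = order G"
    using generate_pow_card[OF g(1)] gen by (simp add: order_def)
  have pos: "order G > 0" using fin order_gt_0_iff_finite by blast
  have powM: "g [^] q \<in> M" if "prime q" "q dvd order G" for q :: nat
  proof (rule nongen)
    have "ord (g [^] q) = order G div q"
      using g that ordg by (simp add: ord_pow prime_gt_0_nat)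
    moreover have "order G div q < order G"
      using pos that prime_gt_1_nat[of q] by simp
    ultimately show "generate G {g [^] q} \<noteq> carrier G"
      using generate_pow_card[of "g [^] q"] g by (auto simp: order_def)
  qed (use g in simp)
  have "g \<noteq> \<one>" using g(2) M(1) subgroup.one_closed by blast
  then have "order G \<noteq> 1" using ordg ord_eq_1[OF g(1)] by auto
  then obtain p where p: "prime p" "p dvd order G" using prime_factor_nat by blast
  have uniq: "q = p" if "prime q" "q dvd order G" for q
    using mem_subgroup_if_coprime_powers[OF M(1) g(1), of p q] powM p that g(2)
      primes_coprime[of p q] by blast
  obtain m where m: "order G = p ^ multiplicity p (order G) * m" "\<not> p dvd m"
    using multiplicity_decompose'[of "order G" p] pos p(1) prime_gt_1_nat[of p] by auto
  have "m = 1"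
  proof (rule ccontr)
    assume "m \<noteq> 1"
    then obtain q where "prime q" "q dvd m" using prime_factor_nat by blast
    then show False using uniq[of q] m by (metis dvd_mult)
  qed
  then have "order G = p ^ multiplicity p (order G)" using m(1) by simp
  then show ?thesis
    using p(1) g(1) gen cyclic_group_iff_generate by blast
qed

text \<open>The order of \<open>g^m\<close> depends only on the greatest common divisor of \<open>m\<close> and \<open>p^k\<close>, which is some
  \<open>p^i\<close>; so every subgroup \<open>\<langle>g^m\<rangle>\<close> is a member \<open>S i = \<langle>g^(p^i)\<rangle>\<close> of a chain. The ends \<open>i = 0\<close> and
  \<open>i = k\<close> are the whole group and the trivial group, which leaves \<open>k - 1\<close> vertices. With truncated
  subtraction the count is also right for \<open>k = 0\<close>.\<close>

lemma proper_cyclic_subgroups_cyclic_prime_power: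
  assumes fin: "finite (carrier G)" and cyc: "cyclic_group G"
    and p: "prime p" and n: "order G = p ^ k"
  shows "card (proper_cyclic_subgroups G) = k - 1"
    and "H \<in> proper_cyclic_subgroups G \<Longrightarrow> K \<in> proper_cyclic_subgroups G \<Longrightarrow> H \<inter> K \<noteq> {\<one>}"
proof -
  obtain g where g: "g \<in> carrier G" "generate G {g} = carrier G"
    using cyc cyclic_group_iff_generate by blast
  have ordg: "ord g = p ^ k"
    using generate_pow_card[OF g(1)] g(2) n by (simp add: order_def)
  have p1: "p > 1" using p by (rule prime_gt_1_nat)
  define S where "S i = generate G {g [^] (p ^ i)}" for i
  have card_S: "card (S i) = p ^ (k - i)" if "i \<le> k" for i
    using that g p1 generate_pow_card[of "g [^] (p ^ i)"]
    by (simp add: S_def ord_pow ordg le_imp_power_dvd power_diff)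
  have inj: "inj_on S {0<..<k}"
  proof (rule inj_onI)
    fix i j assume ij: "i \<in> {0<..<k}" "j \<in> {0<..<k}" "S i = S j"
    then have "p ^ (k - i) = p ^ (k - j)" using card_S[of i] card_S[of j] by simp
    then have "k - i = k - j" using p1 by simp
    then show "i = j" using ij by auto
  qed
  have eq: "proper_cyclic_subgroups G = S ` {0<..<k}"
  proof (intro equalityI subsetI)
    fix H assume "H \<in> proper_cyclic_subgroups G"
    then obtain x where x: "x \<in> carrier G" "x \<noteq> \<one>" "H = generate G {x}" "H \<noteq> carrier G"
      by (auto simp: mem_proper_cyclic_subgroups_iff)
    obtain m :: nat where m: "x = g [^] m"
      using x(1) g generate_pow_on_finite_carrier[OF fin g(1)] by auto
    then have "m \<noteq> 0" using x(2) by (metis nat_pow_0)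
    obtain i where i: "i \<le> k" "gcd (p ^ k) m = p ^ i"
      using divides_primepow_nat[OF p, of "gcd (p ^ k) m" k] by auto
    have "ord x = p ^ k div p ^ i"
      using ord_pow_gen[OF g(1), of m] \<open>m \<noteq> 0\<close> i m ordg by simp
    then have card_H: "card H = card (S i)"
      using generate_pow_card[OF x(1)] x(3) card_S[OF i(1)] i(1) p1 by (simp add: power_diff)
    \<comment> \<open>As \<open>H\<close> and \<open>S i\<close> have equally many elements, one inclusion suffices.\<close>
    have "p ^ i dvd m" using i(2) by (metis gcd_dvd2)
    then obtain c where "m = p ^ i * c" ..
    then have "x = (g [^] (p ^ i)) [^] c" using m g(1) by (simp add: nat_pow_pow)
    then have "x \<in> S i" using nat_pow_mem_generate g(1) by (simp add: S_def)
    then have "H \<subseteq> S i"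
      using generate_singleton_mono[of "g [^] (p ^ i)" x] g(1) x(3) by (simp add: S_def)
    moreover have "finite (S i)"
      using fin generate_incl[of "{g [^] (p ^ i)}"] g(1) finite_subset by (auto simp: S_def)
    ultimately have "H = S i" using card_H by (metis card_subset_eq)
    moreover have "i \<noteq> 0"
    proof
      assume "i = 0"
      then have "S i = carrier G" using g by (simp add: S_def)
      then show False using \<open>H = S i\<close> x(4) by simp
    qed
    moreover have "i \<noteq> k"
    proof
      assume "i = k"
      then have "ord x = 1" using \<open>ord x = _\<close> p1 by simp
      then show False using ord_eq_1[OF x(1)] x(2) by simp
    qed
    ultimately show "H \<in> S ` {0<..<k}" using i(1) by (intro image_eqI[of _ _ i]) simp_all
  next
    fix H assume "H \<in> S ` {0<..<k}"
    then obtain i where i: "0 < i" "i < k" "H = S i" by auto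
    have "card H \<noteq> 1" using card_S[of i] i p1 by simp
    then have "g [^] (p ^ i) \<noteq> \<one>" using i(3) by (auto simp: S_def generate_one)
    moreover have "p ^ (k - i) < p ^ k" using i p1 by (intro power_strict_increasing) auto
    then have "H \<noteq> carrier G" using card_S[of i] i n by (auto simp: order_def)
    ultimately show "H \<in> proper_cyclic_subgroups G"
      using g(1) i(3) by (auto simp: mem_proper_cyclic_subgroups_iff S_def)
  qed
  show "card (proper_cyclic_subgroups G) = k - 1"
    unfolding eq using card_image[OF inj] by simp
  assume HK: "H \<in> proper_cyclic_subgroups G" "K \<in> proper_cyclic_subgroups G"
  have anti: "S j \<subseteq> S i" if "i \<le> j" for i j
  proof -
    have "g [^] (p ^ j) = (g [^] (p ^ i)) [^] (p ^ (j - i))"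
      using g(1) that by (simp add: nat_pow_pow flip: power_add)
    then show ?thesis
      unfolding S_def using g(1) by (intro generate_singleton_mono) (auto intro: nat_pow_mem_generate)
  qed
  obtain i j where "H = S i" "K = S j" using HK eq by auto
  then have "H \<subseteq> K \<or> K \<subseteq> H" using anti nat_le_linear by blast
  then have "H \<inter> K \<in> {H, K}" by blast
  then show "H \<inter> K \<noteq> {\<one>}" using HK by (auto simp: proper_cyclic_subgroups_def)
qed

text \<open>Cyclicity passes to \<open>\<int>/n\<close> from \<open>\<int>\<close> and then to \<open>G\<close>. Conversely, for a generator \<open>g\<close> the powers
  \<open>g^i\<close> depend exactly on \<open>i\<close> modulo \<open>n\<close>, so \<open>i \<mapsto> g^i\<close> is an isomorphism.\<close>

lemma iso_integer_mod_group_iff: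
  assumes "n > 0"
  shows "G \<cong> integer_mod_group n \<longleftrightarrow> cyclic_group G \<and> order G = n"
proof
  assume iso: "G \<cong> integer_mod_group n"
  have "(\<lambda>x. x mod int n) \<in> epi integer_group (integer_mod_group n)"
  proof -
    have "x \<in> range (\<lambda>x. x mod int n)" if "0 \<le> x" "x < int n" for x
      using that by (intro image_eqI[of _ _ x]) auto
    then show ?thesis
      using assms by (auto simp: epi_def hom_def carrier_integer_mod_group mod_add_eq)
  qed
  then have "cyclic_group (integer_mod_group n)"
    by (rule group.cyclic_group_epimorphic_image[OF group_integer_group]) simp_all
  then have "cyclic_group G"
    using isomorphic_group_cyclicity[OF iso] group_axioms by simp
  moreover have "order G = n"
    using iso_same_card[OF iso] assms by (simp add: order_def carrier_integer_mod_group)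
  ultimately show "cyclic_group G \<and> order G = n" ..
next
  assume "cyclic_group G \<and> order G = n"
  then obtain g where g: "g \<in> carrier G" "generate G {g} = carrier G" and n: "order G = n"
    using cyclic_group_iff_generate by blast
  have ordg: "ord g = n" using generate_pow_card[OF g(1)] g(2) n by (simp add: order_def)
  let ?f = "\<lambda>i::int. g [^] i"
  have carr: "carrier (integer_mod_group n) = {0..<int n}"
    using assms by (simp add: carrier_integer_mod_group)
  have mod: "g [^] (i mod int n) = g [^] i" for i
    using int_pow_eq[OF g(1)] ordg by (simp add: mod_eq_dvd_iff[symmetric])
  have "?f \<in> hom (integer_mod_group n) G"
    using g(1) by (intro homI) (auto simp: mod int_pow_mult)
  moreover have "inj_on ?f {0..<int n}"
  proof (rule inj_onI)
    fix i j assume ij: "i \<in> {0..<int n}" "j \<in> {0..<int n}" "g [^] i = g [^] j"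
    then have "int n dvd j - i"
      using int_pow_eq[OF g(1)] ordg by simp
    then have "j mod int n = i mod int n" by (simp only: mod_eq_dvd_iff)
    then show "i = j" using ij by simp
  qed
  moreover have "?f ` {0..<int n} = carrier G"
  proof (intro equalityI subsetI)
    fix x assume "x \<in> carrier G"
    then obtain i :: int where "x = g [^] i" using g generate_pow[OF g(1)] by auto
    then have "x = ?f (i mod int n)" by (simp add: mod)
    then show "x \<in> ?f ` {0..<int n}" using assms by simp
  qed (use g(1) in auto)
  ultimately have "?f \<in> iso (integer_mod_group n) G"
    by (simp add: iso_def bij_betw_def carr)
  then show "G \<cong> integer_mod_group n"
    using group.iso_sym[OF group_integer_mod_group] is_isoI by blast
qed

section \<open>Star-shaped intersection graphs\<close>

text \<open>A star has a vertex \<open>M\<close> that contains all the others: either the centre or, if the centre lies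
  inside a leaf, that leaf, which is then the only one. All elements outside \<open>M\<close> are generators.\<close>

lemma cyclic_prime_power_if_star:
  assumes fin: "finite (carrier G)" and star: "star_graph (with_proj (cyclic_intersection_graph G))"
  shows "cyclic_group G \<and> (\<exists>p k. prime p \<and> order G = p ^ k)"
proof -
  let ?P = "proper_cyclic_subgroups G"
  have "pverts (cyclic_intersection_graph G) = ?P"
    by (simp add: cyclic_intersection_graph_def)
  then obtain C V where V: "V \<noteq> {}" "C \<notin> V" "?P = insert C V"
    and arcs: "parcs (cyclic_intersection_graph G) = {C} \<times> V \<union> V \<times> {C}"
    using star unfolding star_graph_with_proj_iff by metis
  have adj: "H \<inter> K \<noteq> {\<one>} \<longleftrightarrow> H = C \<or> K = C" if "H \<in> ?P" "K \<in> ?P" "H \<noteq> K" for H K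
  proof -
    have "H \<inter> K \<noteq> {\<one>} \<longleftrightarrow> (H, K) \<in> parcs (cyclic_intersection_graph G)"
      using that by (simp add: cyclic_intersection_graph_def)
    then show ?thesis using that V(2,3) unfolding arcs by auto
  qed
  have nontriv: "H \<noteq> {\<one>}" if "H \<in> ?P" for H
    using that by (simp add: proper_cyclic_subgroups_def)
  have comparable: "C \<subseteq> L \<or> L \<subseteq> C" if "L \<in> V" for L
  proof (rule proper_cyclic_subgroups_comparable_if)
    show CL: "C \<in> ?P" "L \<in> ?P" using V(3) that by auto
    show "C \<inter> L \<noteq> {\<one>}" using adj[OF CL] V(2) that by blast
    fix J assume J: "J \<in> ?P" "J \<subseteq> C \<inter> L"
    \<comment> \<open>If \<open>J\<close> is not the centre, then it is a leaf, and two distinct leaves meet trivially.\<close>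
    then have "J \<inter> L = J" by blast
    then show "J = C \<or> J = L" using adj[OF J(1) CL(2)] nontriv[OF J(1)] V(2) that by metis
  qed
  have "\<exists>M\<in>?P. \<forall>H\<in>?P. H \<subseteq> M"
  proof (cases "\<exists>L\<in>V. C \<subseteq> L")
    case True
    then obtain L where L: "L \<in> V" "C \<subseteq> L" by blast
    have "L' = L" if "L' \<in> V" for L'
    proof (rule ccontr)
      assume ne: "L' \<noteq> L"
      have "L' \<in> ?P" "L \<in> ?P" "C \<in> ?P" using V(3) L that by auto
      moreover have "L' \<inter> L = {\<one>}" using adj[of L' L] ne L that V(2,3) by blast
      \<comment> \<open>\<open>L'\<close> contains \<open>C\<close> or lies in \<open>C\<close>, and \<open>C\<close> lies in \<open>L\<close>.\<close>
      moreover have "C \<subseteq> L' \<inter> L \<or> L' \<subseteq> L' \<inter> L" using comparable[OF that] L(2) by blast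
      ultimately have "C \<subseteq> {\<one>} \<or> L' \<subseteq> {\<one>}" by simp
      moreover have "\<one> \<in> C" "\<one> \<in> L'"
        using \<open>C \<in> ?P\<close> \<open>L' \<in> ?P\<close> subgroup.one_closed by (auto simp: proper_cyclic_subgroups_def)
      ultimately show False using nontriv \<open>C \<in> ?P\<close> \<open>L' \<in> ?P\<close> by blast
    qed
    then show ?thesis using V(3) L by blast
  next
    case False
    then show ?thesis using comparable V(3) by blast
  qed
  then obtain M where M: "M \<in> ?P" "\<And>H. H \<in> ?P \<Longrightarrow> H \<subseteq> M" by blast
  have subM: "subgroup M G" "M \<noteq> carrier G"
    using M(1) by (auto simp: proper_cyclic_subgroups_def)
  show ?thesis
  proof (rule cyclic_prime_power_if_nongenerators_subset[OF fin subM])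
    fix x assume x: "x \<in> carrier G" "generate G {x} \<noteq> carrier G"
    show "x \<in> M"
    proof (cases "x = \<one>")
      case True
      then show ?thesis using subM(1) subgroup.one_closed by blast
    next
      case False
      then have "generate G {x} \<in> ?P" using x by (auto simp: mem_proper_cyclic_subgroups_iff)
      then show ?thesis using M(2) generate.incl[of x "{x}" G] by blast
    qed
  qed
qed

lemma star_iff_cube_if_cyclic_prime_power:
  assumes "finite (carrier G)" "cyclic_group G" "prime p" "order G = p ^ k"
  shows "star_graph (with_proj (cyclic_intersection_graph G)) \<longleftrightarrow> k = 3"
proof -
  let ?X = "cyclic_intersection_graph G"
  have verts: "pverts ?X = proper_cyclic_subgroups G"
    by (simp add: cyclic_intersection_graph_def)
  have "parcs ?X = {(H, K). H \<in> pverts ?X \<and> K \<in> pverts ?X \<and> H \<noteq> K}"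
    using proper_cyclic_subgroups_cyclic_prime_power(2)[OF assms]
    by (auto simp: cyclic_intersection_graph_def)
  then have "star_graph (with_proj ?X) \<longleftrightarrow> card (proper_cyclic_subgroups G) = 2"
    unfolding verts[symmetric] by (rule star_graph_with_proj_complete_iff)
  then show ?thesis
    using proper_cyclic_subgroups_cyclic_prime_power(1)[OF assms] by auto
qed

end

theorem theorem2p5:
  fixes G :: "('a, 'b) monoid_scheme"
  assumes "group G" and "finite (carrier G)"
  shows "star_graph (with_proj (cyclic_intersection_graph G)) \<longleftrightarrow>
         (\<exists>p::nat. prime p \<and> G \<cong> integer_mod_group (p ^ 3))"
proof -
  interpret group G by fact
  have "(\<exists>p::nat. prime p \<and> G \<cong> integer_mod_group (p ^ 3)) \<longleftrightarrow>
        (\<exists>p. prime p \<and> cyclic_group G \<and> order G = p ^ 3)"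
    by (intro ex_cong1 conj_cong refl iso_integer_mod_group_iff) (simp add: prime_gt_0_nat)
  also have "\<dots> \<longleftrightarrow> star_graph (with_proj (cyclic_intersection_graph G))"
    using cyclic_prime_power_if_star[OF assms(2)] star_iff_cube_if_cyclic_prime_power[OF assms(2)]
    by blast
  finally show ?thesis ..
qed

end
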